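(* Let $\mathcal{V}$ be a finite ground set, $k\ge2$ and $1\le\tau\le k$ integers with $|\mathcal{V}|\ge k$, $\mu_1,\mu_3,\alpha\in(0,1]$, and $h:\mathcal{H}(\mathcal{V})\to\mathbb{R}_{\ge 0}$ with $h(())=0$ be forward-monotone, $\alpha$-backward-monotone, $\mu_1$-element-sequence-submodular and $\mu_3$-general-sequence-submodular. Let $S$ be the output of Algorithm 2 with parameters $k,\tau$. Then $$\min_{\mathcal{V}'\subseteq\mathcal{V}(S),|\mathcal{V}'|\le\tau}h(S-\mathcal{V}')\ \ge\ \frac{\alpha^2\mu_1\mu_3(e^{\mu_1}-1)}{(\mu_1+\alpha\tau)e^{\mu_1}}\cdot\max_{S'\in\mathcal{H}(\mathcal{V}),|S'|\le k}\ \min_{\mathcal{V}'\subseteq\mathcal{V}(S'),|\mathcal{V}'|\le\tau}h(S'-\mathcal{V}').$$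
   Context: $\mathcal{H}(\mathcal{V})$ denotes the set of all finite sequences of pairwise distinct elements of $\mathcal{V}$, including the empty sequence $()$. For $S\in\mathcal{H}(\mathcal{V})$, $\mathcal{V}(S)$ is the set of its elements and $|S|=|\mathcal{V}(S)|$. For a set $\mathcal{U}$, $S-\mathcal{U}$ is obtained from $S$ by deleting the elements of $\mathcal{U}$ keeping the order of the rest; $S_1$ is a subsequence of $S_2$ if $S_1=S_2-\mathcal{U}$ for some $\mathcal{U}\subseteq\mathcal{V}(S_2)$. For $S_1=(v_1,\dots,v_{m_1})$ and $S_2$ with $S_2-\mathcal{V}(S_1)=(w_1,\dots,w_{m_3})$, $S_1\oplus S_2=(v_1,\dots,v_{m_1},w_1,\dots,w_{m_3})$. $S_1\preceq S_2$ means $S_2=S_1\oplus S_3$ for some $S_3$. $h(S_2\mid S_1)=h(S_1\oplus S_2)-h(S_1)$; $(v)$ is the one-element sequence. $h$ is forward-monotone if $h(S_1\oplus S_2)\ge h(S_1)$ for all $S_1,S_2$; $\alpha$-backward-monotone if $h(S_1\oplus S_2)\ge\alpha h(S_2)$ for all $S_1,S_2$; $\mu_1$-element-sequence-submodular if $h((v)\mid S_1)\ge\mu_1 h((v)\mid S_2)$ for all $v\in\mathcal{V}$ and all $S_1\preceq S_2$; $\mu_3$-general-sequence-submodular if $h(S_3\mid S_1)\ge\mu_3 h(S_3\mid S_2)$ for all $S_3$ and all $S_1,S_2$ with $S_1$ a subsequence of $S_2$. Algorithm 2 (parameters $k,\tau$): Step 1: from $S_1=()$, while $|S_1|<\tau$,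 append $v\in\arg\max_{v\in\mathcal{V}\setminus\mathcal{V}(S_1)}h((v))$ to $S_1$. Step 2: from $S_2=()$, while $|S_2|<k-\tau$, append $v\in\arg\max_{v\in\mathcal{V}\setminus(\mathcal{V}(S_1)\cup\mathcal{V}(S_2))}h((v)\mid S_2)$ to $S_2$. Output $S=S_1\oplus S_2$; ties broken arbitrarily. *)

theory Defs
  imports Complex_Main
begin

definition seqs :: "'a set \<Rightarrow> 'a list set" where
  "seqs V = {S. distinct S \<and> set S \<subseteq> V}"

definition seq_del :: "'a list \<Rightarrow> 'a set \<Rightarrow> 'a list"  (infixl "\<ominus>" 65) where
  "S \<ominus> U = filter (\<lambda>x. x \<notin> U) S"

definition subsequence :: "'a list \<Rightarrow> 'a list \<Rightarrow> bool" where
  "subsequence S1 S2 \<longleftrightarrow> (\<exists>U \<subseteq> set S2. S1 = S2 \<ominus> U)"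

definition seq_join :: "'a list \<Rightarrow> 'a list \<Rightarrow> 'a list"  (infixl "\<oplus>" 65) where
  "S1 \<oplus> S2 = S1 @ (S2 \<ominus> set S1)"

definition seq_prefix :: "'a set \<Rightarrow> 'a list \<Rightarrow> 'a list \<Rightarrow> bool" where
  "seq_prefix V S1 S2 \<longleftrightarrow> (\<exists>S3 \<in> seqs V. S2 = S1 \<oplus> S3)"

text \<open>\<open>marginal h S2 S1\<close> is \<open>h(S2 | S1)\<close>: the second sequence argument is the one conditioned on.\<close>

definition marginal :: "('a list \<Rightarrow> real) \<Rightarrow> 'a list \<Rightarrow> 'a list \<Rightarrow> real" where
  "marginal h S2 S1 = h (S1 \<oplus> S2) - h S1"

definition forward_monotone :: "'a set \<Rightarrow> ('a list \<Rightarrow> real) \<Rightarrow> bool" where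
  "forward_monotone V h \<longleftrightarrow> (\<forall>S1 \<in> seqs V. \<forall>S2 \<in> seqs V. h (S1 \<oplus> S2) \<ge> h S1)"

definition backward_monotone :: "'a set \<Rightarrow> real \<Rightarrow> ('a list \<Rightarrow> real) \<Rightarrow> bool" where
  "backward_monotone V \<alpha> h \<longleftrightarrow>
     (\<forall>S1 \<in> seqs V. \<forall>S2 \<in> seqs V. h (S1 \<oplus> S2) \<ge> \<alpha> * h S2)"

definition element_sequence_submodular :: "'a set \<Rightarrow> real \<Rightarrow> ('a list \<Rightarrow> real) \<Rightarrow> bool" where
  "element_sequence_submodular V \<mu> h \<longleftrightarrow>
     (\<forall>v \<in> V. \<forall>S1 \<in> seqs V. \<forall>S2 \<in> seqs V. seq_prefix V S1 S2 \<longrightarrow>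
        marginal h [v] S1 \<ge> \<mu> * marginal h [v] S2)"

definition general_sequence_submodular :: "'a set \<Rightarrow> real \<Rightarrow> ('a list \<Rightarrow> real) \<Rightarrow> bool" where
  "general_sequence_submodular V \<mu> h \<longleftrightarrow>
     (\<forall>S3 \<in> seqs V. \<forall>S1 \<in> seqs V. \<forall>S2 \<in> seqs V. subsequence S1 S2 \<longrightarrow>
        marginal h S3 S1 \<ge> \<mu> * marginal h S3 S2)"

text \<open>
  The algorithm breaks ties arbitrarily, so each of its two loops is given by the set of states
  reachable at the loop head, and an output is a reachable state at which the loop guard fails.
\<close>

inductive step1_state :: "'a set \<Rightarrow> ('a list \<Rightarrow> real) \<Rightarrow> nat \<Rightarrow> 'a list \<Rightarrow> bool"
  for V h \<tau> where
  init: "step1_state V h \<tau> []"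
| step: "step1_state V h \<tau> S1 \<Longrightarrow> card (set S1) < \<tau> \<Longrightarrow>
    is_arg_max (\<lambda>v. h [v]) (\<lambda>v. v \<in> V - set S1) v \<Longrightarrow>
    step1_state V h \<tau> (S1 @ [v])"

inductive step2_state ::
  "'a set \<Rightarrow> ('a list \<Rightarrow> real) \<Rightarrow> nat \<Rightarrow> nat \<Rightarrow> 'a list \<Rightarrow> 'a list \<Rightarrow> bool"
  for V h k \<tau> S1 where
  init: "step2_state V h k \<tau> S1 []"
| step: "step2_state V h k \<tau> S1 S2 \<Longrightarrow> card (set S2) < k - \<tau> \<Longrightarrow>
    is_arg_max (\<lambda>v. marginal h [v] S2) (\<lambda>v. v \<in> V - (set S1 \<union> set S2)) v \<Longrightarrow>
    step2_state V h k \<tau> S1 (S2 @ [v])"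

definition algorithm2_output ::
  "'a set \<Rightarrow> ('a list \<Rightarrow> real) \<Rightarrow> nat \<Rightarrow> nat \<Rightarrow> 'a list \<Rightarrow> bool" where
  "algorithm2_output V h k \<tau> S \<longleftrightarrow>
     (\<exists>S1 S2. step1_state V h \<tau> S1 \<and> \<not> card (set S1) < \<tau> \<and>
        step2_state V h k \<tau> S1 S2 \<and> \<not> card (set S2) < k - \<tau> \<and>
        S = S1 \<oplus> S2)"

definition robust_value :: "('a list \<Rightarrow> real) \<Rightarrow> nat \<Rightarrow> 'a list \<Rightarrow> real" where
  "robust_value h \<tau> S = (MIN U \<in> {U. U \<subseteq> set S \<and> card U \<le> \<tau>}. h (S \<ominus> U))"

end

theory Submission
  imports Defs
begin

text \<open>
  Write the output as \<open>S1 @ S2\<close>. Deleting \<open>\<tau>\<close> elements of an optimal sequence, among them all that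
  lie in \<open>S1\<close>, leaves a sequence \<open>T\<close> of at most \<open>k - \<tau>\<close> elements outside \<open>S1\<close> whose value is at least
  the optimum. The usual greedy recursion gives \<open>h S2 \<ge> \<alpha> (1 - exp (-\<mu>\<^sub>1)) h T\<close>. Now let \<open>U\<close> be
  deleted from \<open>S1 @ S2\<close>. If \<open>U\<close> misses \<open>S2\<close>, backward monotonicity bounds the loss. Otherwise some
  \<open>v\<close> of \<open>S1\<close> survives, its singleton value dominates that of each deleted element of \<open>S2\<close>, and
  splitting \<open>h S2\<close> into marginals of surviving and of deleted elements gives
  \<open>h S2 \<le> h (S2 \<ominus> U) / \<mu>\<^sub>3 + \<tau> h [v] / \<mu>\<^sub>1\<close>.
\<close>

section \<open>Sequences under deletion and concatenation\<close>

lemma seqs_Nil [simp]: "[] \<in> seqs V"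
  by (simp add: seqs_def)

lemma seqs_singleton_iff [simp]: "[v] \<in> seqs V \<longleftrightarrow> v \<in> V"
  by (simp add: seqs_def)

lemma seqs_snoc_iff: "W @ [w] \<in> seqs V \<longleftrightarrow> W \<in> seqs V \<and> w \<in> V - set W"
  by (auto simp: seqs_def)

lemma seq_del_in_seqs [simp]: "S \<in> seqs V \<Longrightarrow> S \<ominus> U \<in> seqs V"
  by (auto simp: seqs_def seq_del_def)

lemma seq_join_in_seqs [simp]: "S1 \<in> seqs V \<Longrightarrow> S2 \<in> seqs V \<Longrightarrow> S1 \<oplus> S2 \<in> seqs V"
  by (auto simp: seqs_def seq_join_def seq_del_def)

lemma set_seq_del [simp]: "set (S \<ominus> U) = set S - U"
  by (auto simp: seq_del_def)

lemma seq_del_eq_self: "set S \<inter> U = {} \<Longrightarrow> S \<ominus> U = S"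
  by (auto simp: seq_del_def filter_id_conv)

lemma seq_del_append: "(S @ T) \<ominus> U = (S \<ominus> U) @ (T \<ominus> U)"
  by (simp add: seq_del_def)

lemma seq_join_Nil [simp]: "[] \<oplus> S = S" "S \<oplus> [] = S"
  by (simp_all add: seq_join_def seq_del_def)

lemma seq_join_eq_append: "set S \<inter> set T = {} \<Longrightarrow> S \<oplus> T = S @ T"
  by (simp add: seq_join_def seq_del_eq_self Int_commute)

lemma seq_join_snoc: "t \<notin> set T \<Longrightarrow> A \<oplus> (T @ [t]) = (A \<oplus> T) \<oplus> [t]"
  by (auto simp: seq_join_def seq_del_def)

lemma subsequence_seq_del: "subsequence (S \<ominus> U) S"
  unfolding subsequence_def
  \<comment> \<open>The witness is cut down to \<open>set S\<close>, since
    \<open>subsequence\<close> admits only sets of elements of \<open>S\<close>.\<close>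
  by (rule exI[of _ "U \<inter> set S"]) (auto simp: seq_del_def intro: filter_cong)

lemma finite_seqs: "finite V \<Longrightarrow> finite (seqs V)"
  unfolding seqs_def
  by (rule finite_subset[OF _ finite_subset_distinct[of V]]) auto

section \<open>Bounds on minima and maxima\<close>

lemma robust_value_le: "U \<subseteq> set S \<Longrightarrow> card U \<le> \<tau> \<Longrightarrow> robust_value h \<tau> S \<le> h (S \<ominus> U)"
  unfolding robust_value_def by (rule Min_le) auto

lemma robust_value_geI:
  assumes "\<And>U. U \<subseteq> set S \<Longrightarrow> card U \<le> \<tau> \<Longrightarrow> c \<le> h (S \<ominus> U)"
  shows "c \<le> robust_value h \<tau> S"
  unfolding robust_value_def
proof (rule Min.boundedI)
  show "(\<lambda>U. h (S \<ominus> U)) ` {U. U \<subseteq> set S \<and> card U \<le> \<tau>} \<noteq> {}"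
    by (auto intro!: exI[of _ "{}"])
qed (auto simp: assms)

text \<open>The maximum is attained, so bounding each candidate suffices, whatever the sign of
  \<open>c\<close>.\<close>

lemma mult_Max_leI:
  fixes c :: real
  assumes "finite A" "A \<noteq> {}" and "\<And>x. x \<in> A \<Longrightarrow> c * f x \<le> b"
  shows "c * Max (f ` A) \<le> b"
proof -
  have "Max (f ` A) \<in> f ` A"
    using assms(1,2) by simp
  then obtain x where "x \<in> A" "Max (f ` A) = f x"
    by (rule imageE)
  then show ?thesis
    using assms(3) by simp
qed

section \<open>Invariants of the two loops\<close>

lemma step1_state_seqs: "step1_state V h \<tau> S1 \<Longrightarrow> S1 \<in> seqs V"
  by (induction rule: step1_state.induct) (auto simp: seqs_snoc_iff is_arg_max_def)

lemma step1_state_card_le: "step1_state V h \<tau> S1 \<Longrightarrow> card (set S1) \<le> \<tau>"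
  by (induction rule: step1_state.induct) (auto simp: is_arg_max_def)

text \<open>An element still outside \<open>S1\<close> was a candidate in every round so far, and
  each chosen element beat it.\<close>

lemma step1_state_dominates:
  assumes "step1_state V h \<tau> S1" "v \<in> set S1" "w \<in> V - set S1"
  shows "h [w] \<le> h [v]"
  using assms
proof (induction arbitrary: v w rule: step1_state.induct)
  case init
  then show ?case by simp
next
  case (step S1 u)
  then show ?case
    by (auto simp: is_arg_max_linorder)
qed

text \<open>The reduced ground set also records that \<open>S2\<close> avoids
  \<open>S1\<close>.\<close>

lemma step2_state_seqs: "step2_state V h k \<tau> S1 S2 \<Longrightarrow> S2 \<in> seqs (V - set S1)"
  by (induction rule: step2_state.induct) (auto simp: seqs_snoc_iff is_arg_max_def)

lemma step2_state_card_le: "step2_state V h k \<tau> S1 S2 \<Longrightarrow> card (set S2) \<le> k - \<tau>"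
  by (induction rule: step2_state.induct) (auto simp: is_arg_max_def)

section \<open>Greedy analysis of the second loop\<close>

lemma marginal_nonneg:
  "forward_monotone V h \<Longrightarrow> S1 \<in> seqs V \<Longrightarrow> S2 \<in> seqs V \<Longrightarrow> 0 \<le> marginal h S2 S1"
  by (simp add: forward_monotone_def marginal_def)

text \<open>Append \<open>T\<close> to \<open>A\<close> element by element: each increment is
  conditioned on an extension of \<open>A\<close>, and passing back to the prefix \<open>A\<close>
  costs the factor \<mu>.\<close>

lemma marginal_le_sum_marginals:
  assumes "element_sequence_submodular V \<mu> h" "A \<in> seqs V" "T \<in> seqs V"
  shows "\<mu> * marginal h T A \<le> (\<Sum>t\<in>set T. marginal h [t] A)"
  using assms(3)
proof (induction T rule: rev_induct)
  case Nil
  then show ?case by (simp add: marginal_def)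
next
  case (snoc t T)
  then have t: "T \<in> seqs V" "t \<in> V" "t \<notin> set T"
    by (auto simp: seqs_snoc_iff)
  have "seq_prefix V A (A \<oplus> T)"
    using t by (auto simp: seq_prefix_def)
  then have "\<mu> * marginal h [t] (A \<oplus> T) \<le> marginal h [t] A"
    using assms t by (auto simp: element_sequence_submodular_def)
  then show ?case
    using snoc.IH t by (simp add: seq_join_snoc marginal_def algebra_simps)
qed

text \<open>Backward monotonicity makes adding all of \<open>T\<close> worth at least the deficit.
  As \<open>T\<close> avoids \<open>S1\<close>, each of its elements is a candidate or already in
  \<open>S2\<close>, so none gains more than \<open>v\<close>.\<close>

lemma greedy_step_gain:
  assumes "forward_monotone V h" and "backward_monotone V \<alpha> h"
    and "element_sequence_submodular V \<mu> h"
    and "S1 \<in> seqs V" "S2 \<in> seqs V" "T \<in> seqs V"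
    and "set T \<inter> set S1 = {}" "card (set T) \<le> m"
    and amax: "is_arg_max (\<lambda>v. marginal h [v] S2) (\<lambda>v. v \<in> V - (set S1 \<union> set S2)) v"
    and "\<mu> > 0"
  shows "\<mu> * (\<alpha> * h T - h S2) \<le> real m * marginal h [v] S2"
proof -
  have v: "v \<in> V" using amax by (simp add: is_arg_max_def)
  then have nonneg: "0 \<le> marginal h [v] S2"
    using marginal_nonneg[OF assms(1,5), of "[v]"] by simp
  have le: "marginal h [t] S2 \<le> marginal h [v] S2" if t: "t \<in> set T" for t
  proof (cases "t \<in> set S2")
    case True
    \<comment> \<open>Joining an element already present changes nothing.\<close>
    then have "marginal h [t] S2 = 0"
      by (simp add: marginal_def seq_join_def seq_del_def)
    then show ?thesis using nonneg by simp
  next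
    case False
    then have "t \<in> V - (set S1 \<union> set S2)"
      using t assms by (auto simp: seqs_def)
    then show ?thesis
      using amax by (auto simp: is_arg_max_linorder)
  qed
  have "\<alpha> * h T \<le> h (S2 \<oplus> T)"
    using assms by (simp add: backward_monotone_def)
  then have "\<mu> * (\<alpha> * h T - h S2) \<le> \<mu> * marginal h T S2"
    using assms by (simp add: marginal_def)
  also have "\<dots> \<le> (\<Sum>t\<in>set T. marginal h [t] S2)"
    by (rule marginal_le_sum_marginals[OF assms(3,5,6)])
  also have "\<dots> \<le> real (card (set T)) * marginal h [v] S2"
    by (rule sum_bounded_above) (rule le)
  also have "\<dots> \<le> real m * marginal h [v] S2"
    using assms nonneg by (intro mult_right_mono) auto
  finally show ?thesis .
qed

text \<open>Each round shrinks the deficit by the same factor; \<open>card (set S2)\<close> counts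
  the rounds.\<close>

lemma step2_state_deficit:
  assumes "forward_monotone V h" and "backward_monotone V \<alpha> h"
    and "element_sequence_submodular V \<mu> h" and "h [] = 0"
    and "S1 \<in> seqs V" "T \<in> seqs V"
    and "set T \<inter> set S1 = {}" "card (set T) \<le> k - \<tau>"
    and "\<mu> \<in> {0<..1}"
    and "step2_state V h k \<tau> S1 S2"
  shows "\<alpha> * h T - h S2 \<le> (1 - \<mu> / real (k - \<tau>)) ^ card (set S2) * (\<alpha> * h T)"
  using assms(10)
proof (induction rule: step2_state.induct)
  case init
  then show ?case using assms by simp
next
  case (step S2 v)
  define m where "m = real (k - \<tau>)"
  have m: "m \<ge> 1" using step.hyps by (simp add: m_def)
  have S2: "S2 \<in> seqs V"
    using step2_state_seqs[OF step.hyps(1)] by (auto simp: seqs_def)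
  have v: "v \<notin> set S2" using step.hyps by (simp add: is_arg_max_def)
  have "\<mu> * (\<alpha> * h T - h S2) \<le> m * (h (S2 @ [v]) - h S2)"
    using greedy_step_gain[OF assms(1-3,5) S2 assms(6-8) step.hyps(3)] assms(9) v
    by (simp add: m_def marginal_def seq_join_eq_append)
  then have "\<mu> / m * (\<alpha> * h T - h S2) \<le> h (S2 @ [v]) - h S2"
    using m by (simp add: field_simps)
  then have "\<alpha> * h T - h (S2 @ [v]) \<le> (1 - \<mu> / m) * (\<alpha> * h T - h S2)"
    by (simp add: algebra_simps)
  \<comment> \<open>The induction hypothesis may be multiplied by this factor because \<mu> \<le> 1
    \<le> \<open>m\<close>.\<close>
  also have "\<dots> \<le> (1 - \<mu> / m) * ((1 - \<mu> / m) ^ card (set S2) * (\<alpha> * h T))"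
    using step.IH m assms(9) by (intro mult_left_mono) (auto simp: m_def)
  finally show ?case using v by (simp add: m_def)
qed

lemma step2_output_ge:
  assumes "forward_monotone V h" and "backward_monotone V \<alpha> h"
    and "element_sequence_submodular V \<mu> h" and "h [] = 0"
    and "\<forall>T \<in> seqs V. h T \<ge> 0"
    and "S1 \<in> seqs V" "T \<in> seqs V"
    and "set T \<inter> set S1 = {}" "card (set T) \<le> k - \<tau>"
    and "\<mu> \<in> {0<..1}" "\<alpha> > 0"
    and "step2_state V h k \<tau> S1 S2" "\<not> card (set S2) < k - \<tau>"
  shows "\<alpha> * (1 - exp (- \<mu>)) * h T \<le> h S2"
proof (cases "k - \<tau> = 0")
  \<comment> \<open>With no rounds to run, \<open>T\<close> is empty and the left side
    vanishes.\<close>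
  case True
  have "S2 \<in> seqs V"
    using step2_state_seqs[OF assms(12)] by (auto simp: seqs_def)
  then show ?thesis using True assms by simp
next
  case False
  then have m: "k - \<tau> > 0" by simp
  have card: "card (set S2) = k - \<tau>"
    using step2_state_card_le[OF assms(12)] assms(13) by simp
  have "\<alpha> * h T - h S2 \<le> (1 - \<mu> / real (k - \<tau>)) ^ (k - \<tau>) * (\<alpha> * h T)"
    using step2_state_deficit[OF assms(1-4,6-10,12)] card by simp
  also have "\<dots> \<le> exp (- \<mu>) * (\<alpha> * h T)"
    using m assms by (intro mult_right_mono exp_ge_one_minus_x_over_n_power_n) auto
  finally show ?thesis by (simp add: algebra_simps)
qed

section \<open>Loss caused by deletions\<close>

text \<open>Build \<open>W\<close> from the left. A deleted element gained at most
  \<open>1 / \<mu>\<^sub>1\<close> times its singleton value, by comparison with the empty prefix. A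
  kept one gained at most \<open>1 / \<mu>\<^sub>3\<close> times what it gains on the subsequence of
  survivors. Denominators are cleared.\<close>

lemma seq_del_loss_bound:
  assumes elem: "element_sequence_submodular V \<mu>\<^sub>1 h"
    and gen: "general_sequence_submodular V \<mu>\<^sub>3 h"
    and "h [] = 0" "\<mu>\<^sub>1 > 0" "\<mu>\<^sub>3 > 0"
    and "W \<in> seqs V"
  shows "\<mu>\<^sub>1 * \<mu>\<^sub>3 * h W \<le> \<mu>\<^sub>1 * h (W \<ominus> U) + \<mu>\<^sub>3 * (\<Sum>u\<in>set W \<inter> U. h [u])"
  using assms(6)
proof (induction W rule: rev_induct)
  case Nil
  then show ?case using assms by (simp add: seq_del_def)
next
  case (snoc w W)
  then have w: "W \<in> seqs V" "w \<in> V" "w \<notin> set W"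
    by (auto simp: seqs_snoc_iff)
  show ?case
  proof (cases "w \<in> U")
    case True
    have "seq_prefix V [] W"
      using w by (auto simp: seq_prefix_def)
    then have "\<mu>\<^sub>1 * marginal h [w] W \<le> marginal h [w] []"
      using elem w by (auto simp: element_sequence_submodular_def)
    then have "\<mu>\<^sub>1 * (h (W @ [w]) - h W) \<le> h [w]"
      using w assms(3) by (simp add: marginal_def seq_join_eq_append)
    then have "\<mu>\<^sub>3 * (\<mu>\<^sub>1 * (h (W @ [w]) - h W)) \<le> \<mu>\<^sub>3 * h [w]"
      using assms(5) by simp
    moreover have "(W @ [w]) \<ominus> U = W \<ominus> U"
      using True by (simp add: seq_del_def)
    ultimately show ?thesis
      using snoc.IH w True by (simp add: algebra_simps)
  next
    case False
    have "\<mu>\<^sub>3 * marginal h [w] W \<le> marginal h [w] (W \<ominus> U)"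
      using gen w subsequence_seq_del[of W U] by (auto simp: general_sequence_submodular_def)
    then have "\<mu>\<^sub>3 * (h (W @ [w]) - h W) \<le> h ((W \<ominus> U) @ [w]) - h (W \<ominus> U)"
      using w by (simp add: marginal_def seq_join_eq_append)
    then have "\<mu>\<^sub>1 * (\<mu>\<^sub>3 * (h (W @ [w]) - h W)) \<le> \<mu>\<^sub>1 * (h ((W \<ominus> U) @ [w]) - h (W \<ominus> U))"
      using assms(4) by simp
    moreover have "(W @ [w]) \<ominus> U = (W \<ominus> U) @ [w]"
      using False by (simp add: seq_del_def)
    ultimately show ?thesis
      using snoc.IH w False by (simp add: algebra_simps)
  qed
qed

text \<open>In the coefficient, \<open>\<mu>\<^sub>1\<close> pays for the survivors of
  \<open>S2\<close> and \<open>\<alpha> * real \<tau>\<close> for its deleted elements.\<close>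

lemma robust_loss_bound:
  assumes fwd: "forward_monotone V h" and bwd: "backward_monotone V \<alpha> h"
    and "element_sequence_submodular V \<mu>\<^sub>1 h"
    and "general_sequence_submodular V \<mu>\<^sub>3 h"
    and "h [] = 0" and nonneg: "\<forall>T \<in> seqs V. h T \<ge> 0"
    and \<mu>: "\<mu>\<^sub>1 \<in> {0<..1}" "\<mu>\<^sub>3 \<in> {0<..1}" "\<alpha> \<in> {0<..1}"
    and S: "S1 \<in> seqs V" "S2 \<in> seqs V" "set S1 \<inter> set S2 = {}"
    and dom: "\<And>v w. v \<in> set S1 \<Longrightarrow> w \<in> set S2 \<Longrightarrow> h [w] \<le> h [v]"
    and U: "card (set S1) = \<tau>" "U \<subseteq> set (S1 @ S2)" "card U \<le> \<tau>"
  shows "\<alpha> * \<mu>\<^sub>1 * \<mu>\<^sub>3 * h S2 \<le> (\<mu>\<^sub>1 + \<alpha> * real \<tau>) * h ((S1 @ S2) \<ominus> U)"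
proof -
  define R where "R = (S1 @ S2) \<ominus> U"
  \<comment> \<open>This form lets backward monotonicity compare \<open>R\<close> with its
    suffix.\<close>
  have R: "R = (S1 \<ominus> U) \<oplus> (S2 \<ominus> U)"
    using S by (subst seq_join_eq_append) (auto simp: R_def seq_del_append)
  have "h R \<ge> 0" using S nonneg by (simp add: R)
  have suffix_le: "\<alpha> * h (S2 \<ominus> U) \<le> h R"
    using bwd S by (simp add: R backward_monotone_def)
  have "\<alpha> * \<mu>\<^sub>1 * \<mu>\<^sub>3 * h S2 \<le> (\<mu>\<^sub>1 + \<alpha> * real \<tau>) * h R"
  proof (cases "U \<inter> set S2 = {}")
    case True
    have "\<alpha> * \<mu>\<^sub>1 * \<mu>\<^sub>3 * h S2 = \<mu>\<^sub>1 * \<mu>\<^sub>3 * (\<alpha> * h (S2 \<ominus> U))"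
      using True by (subst seq_del_eq_self) auto
    also have "\<dots> \<le> \<mu>\<^sub>1 * \<mu>\<^sub>3 * h R"
      using suffix_le \<mu> by (intro mult_left_mono) auto
    also have "\<dots> \<le> (\<mu>\<^sub>1 + \<alpha> * real \<tau>) * h R"
    proof (rule mult_right_mono)
      have "\<mu>\<^sub>1 * \<mu>\<^sub>3 \<le> \<mu>\<^sub>1" "0 \<le> \<alpha> * real \<tau>"
        using \<mu> by (auto simp: mult_left_le)
      then show "\<mu>\<^sub>1 * \<mu>\<^sub>3 \<le> \<mu>\<^sub>1 + \<alpha> * real \<tau>" by linarith
    qed fact
    finally show ?thesis .
  next
    case False
    have "finite U" using U(2) by (rule finite_subset) simp
    \<comment> \<open>Covering the \<tau> elements of \<open>S1\<close> would use up all of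
      \<open>U\<close>, leaving nothing to hit \<open>S2\<close>.\<close>
    have "\<not> set S1 \<subseteq> U"
    proof
      assume sub: "set S1 \<subseteq> U"
      then have "set S1 = U"
        using U \<open>finite U\<close> by (intro card_seteq) auto
      then show False using False S by auto
    qed
    then have "S1 \<ominus> U \<noteq> []"
      by (auto simp: seq_del_def filter_empty_conv)
    \<comment> \<open>The first survivor is taken because it heads \<open>R\<close>, and forward
      monotonicity compares \<open>R\<close> only with its prefixes.\<close>
    then obtain v L where vL: "S1 \<ominus> U = v # L"
      by (cases "S1 \<ominus> U") auto
    then have v: "v \<in> set S1"
      using set_seq_del[of S1 U] by auto
    have "R \<in> seqs V" using S by (simp add: R)
    moreover obtain L' where L': "R = v # L'"
      using vL by (auto simp: R seq_join_def)
    ultimately have "v # L' \<in> seqs V" by simp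
    then have "[v] \<in> seqs V" "L' \<in> seqs V" "[v] \<oplus> L' = v # L'"
      by (auto simp: seqs_def seq_join_eq_append)
    then have hv: "h [v] \<le> h R"
      using fwd L' unfolding forward_monotone_def by metis
    have "(\<Sum>u\<in>set S2 \<inter> U. h [u]) \<le> real (card (set S2 \<inter> U)) * h R"
      using dom[OF v] hv by (intro sum_bounded_above) (meson IntD1 order_trans)
    also have "\<dots> \<le> real \<tau> * h R"
    proof (rule mult_right_mono)
      have "card (set S2 \<inter> U) \<le> card U"
        using \<open>finite U\<close> by (intro card_mono) auto
      then show "real (card (set S2 \<inter> U)) \<le> real \<tau>"
        using U by simp
    qed fact
    finally have deleted: "(\<Sum>u\<in>set S2 \<inter> U. h [u]) \<le> real \<tau> * h R" .
    have "\<mu>\<^sub>1 * \<mu>\<^sub>3 * h S2 \<le> \<mu>\<^sub>1 * h (S2 \<ominus> U) + \<mu>\<^sub>3 * (\<Sum>u\<in>set S2 \<inter> U. h [u])"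
      using \<mu> by (intro seq_del_loss_bound[OF assms(3-5) _ _ S(2)]) auto
    also have "\<mu>\<^sub>3 * (\<Sum>u\<in>set S2 \<inter> U. h [u]) \<le> \<mu>\<^sub>3 * (real \<tau> * h R)"
      using deleted \<mu> by (intro mult_left_mono) auto
    \<comment> \<open>Here \<open>\<mu>\<^sub>3 \<le> 1\<close> is given away, so it does not enter
      the final coefficient.\<close>
    also have "\<dots> \<le> real \<tau> * h R"
      using \<mu> \<open>h R \<ge> 0\<close> by (intro mult_left_le_one_le) auto
    finally have "\<alpha> * (\<mu>\<^sub>1 * \<mu>\<^sub>3 * h S2) \<le> \<alpha> * (\<mu>\<^sub>1 * h (S2 \<ominus> U) + real \<tau> * h R)"
      using \<mu> by (intro mult_left_mono) auto
    also have "\<dots> = \<mu>\<^sub>1 * (\<alpha> * h (S2 \<ominus> U)) + \<alpha> * real \<tau> * h R"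
      by (simp add: algebra_simps)
    also have "\<dots> \<le> \<mu>\<^sub>1 * h R + \<alpha> * real \<tau> * h R"
      using suffix_le \<mu> by (intro add_right_mono mult_left_mono) auto
    finally show ?thesis by (simp add: algebra_simps)
  qed
  then show ?thesis by (simp add: R_def)
qed

section \<open>Comparison with the optimum\<close>

text \<open>The adversary may spend its deletions on the elements of \<open>A\<close> first. Filling
  up to exactly \<tau> deletions leaves at most \<open>k - \<tau>\<close> elements; a sequence too
  short for that is deleted entirely.\<close>

lemma robust_value_le_avoiding:
  assumes "S' \<in> seqs V" "card (set S') \<le> k" "finite A" "card A \<le> \<tau>"
  obtains T where "T \<in> seqs V" "set T \<inter> A = {}" "card (set T) \<le> k - \<tau>"
    "robust_value h \<tau> S' \<le> h T"
proof (cases "card (set S') \<le> \<tau>")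
  case True
  show thesis
  proof
    show "robust_value h \<tau> S' \<le> h (S' \<ominus> set S')"
      using True by (intro robust_value_le) auto
  qed (use assms in auto)
next
  case False
  have "card (A \<inter> set S') \<le> \<tau>"
    using card_mono[of A "A \<inter> set S'"] assms by auto
  then obtain U where U: "A \<inter> set S' \<subseteq> U" "U \<subseteq> set S'" "card U = \<tau>"
    using exists_subset_between[of "A \<inter> set S'" \<tau> "set S'"] False by auto
  show thesis
  proof
    show "robust_value h \<tau> S' \<le> h (S' \<ominus> U)"
      using U by (intro robust_value_le) auto
    have "card (set S' - U) = card (set S') - \<tau>"
      using U by (simp add: card_Diff_subset finite_subset)
    then show "card (set (S' \<ominus> U)) \<le> k - \<tau>"
      using assms by simp
  qed (use assms U in auto)
qed

theorem theorem6:
  fixes V :: "'a set" and h :: "'a list \<Rightarrow> real" and k \<tau> :: nat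
    and \<mu>\<^sub>1 \<mu>\<^sub>3 \<alpha> :: real and S :: "'a list"
  assumes "finite V"
    and "k \<ge> 2" and "1 \<le> \<tau>" and "\<tau> \<le> k" and "card V \<ge> k"
    and "\<mu>\<^sub>1 \<in> {0<..1}" and "\<mu>\<^sub>3 \<in> {0<..1}" and "\<alpha> \<in> {0<..1}"
    and "\<forall>T \<in> seqs V. h T \<ge> 0"
    and "h [] = 0"
    and "forward_monotone V h"
    and "backward_monotone V \<alpha> h"
    and "element_sequence_submodular V \<mu>\<^sub>1 h"
    and "general_sequence_submodular V \<mu>\<^sub>3 h"
    and "algorithm2_output V h k \<tau> S"
  shows "robust_value h \<tau> S \<ge>
    (\<alpha>\<^sup>2 * \<mu>\<^sub>1 * \<mu>\<^sub>3 * (exp \<mu>\<^sub>1 - 1)) / ((\<mu>\<^sub>1 + \<alpha> * real \<tau>) * exp \<mu>\<^sub>1) *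
    (MAX S' \<in> {S' \<in> seqs V. card (set S') \<le> k}. robust_value h \<tau> S')"
proof (rule mult_Max_leI)
  show "finite {S' \<in> seqs V. card (set S') \<le> k}"
    using finite_seqs[OF \<open>finite V\<close>] by simp
  show "{S' \<in> seqs V. card (set S') \<le> k} \<noteq> {}"
    by (auto intro!: exI[of _ "[]"])
next
  fix S' assume S': "S' \<in> {S' \<in> seqs V. card (set S') \<le> k}"
  let ?c = "(\<alpha>\<^sup>2 * \<mu>\<^sub>1 * \<mu>\<^sub>3 * (exp \<mu>\<^sub>1 - 1)) / ((\<mu>\<^sub>1 + \<alpha> * real \<tau>) * exp \<mu>\<^sub>1)"
  have \<mu>: "0 < \<mu>\<^sub>1" "0 < \<mu>\<^sub>3" "0 < \<alpha>"
    using assms by auto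
  then have D: "0 < \<mu>\<^sub>1 + \<alpha> * real \<tau>"
    by (simp add: add_pos_nonneg)
  obtain S1 S2 where S1: "step1_state V h \<tau> S1" "\<not> card (set S1) < \<tau>"
    and S2: "step2_state V h k \<tau> S1 S2" "\<not> card (set S2) < k - \<tau>"
    and S: "S = S1 \<oplus> S2"
    using assms by (auto simp: algorithm2_output_def)
  have S1V: "S1 \<in> seqs V" and card1: "card (set S1) = \<tau>"
    using S1 step1_state_card_le[OF S1(1)] by (auto intro: step1_state_seqs)
  have S2V: "S2 \<in> seqs V" and disj: "set S1 \<inter> set S2 = {}"
    using step2_state_seqs[OF S2(1)] by (auto simp: seqs_def)
  have S_eq: "S = S1 @ S2"
    using S disj by (simp add: seq_join_eq_append)
  have dom: "h [w] \<le> h [v]" if "v \<in> set S1" "w \<in> set S2" for v w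
    using step1_state_dominates[OF S1(1)] that S2V disj by (auto simp: seqs_def)
  \<comment> \<open>Avoiding \<open>S1\<close> makes \<open>T\<close> a fair competitor for the
    second loop.\<close>
  obtain T where T: "T \<in> seqs V" "set T \<inter> set S1 = {}" "card (set T) \<le> k - \<tau>"
    and opt: "robust_value h \<tau> S' \<le> h T"
    using robust_value_le_avoiding[of S' V k "set S1" \<tau> h] S' card1 by auto
  have greedy: "\<alpha> * (1 - exp (- \<mu>\<^sub>1)) * h T \<le> h S2"
    by (rule step2_output_ge[OF assms(11-13,10,9) S1V T assms(6) \<mu>(3) S2])
  show "?c * robust_value h \<tau> S' \<le> robust_value h \<tau> S"
  proof (rule robust_value_geI)
    fix U assume U: "U \<subseteq> set S" "card U \<le> \<tau>"
    have "?c * robust_value h \<tau> S' \<le> ?c * h T"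
      using opt \<mu> D by (intro mult_left_mono) auto
    \<comment> \<open>The quotient of exponentials becomes \<open>1 - exp (- \<mu>\<^sub>1)\<close>.
      One \<alpha> goes to the greedy bound, the other to the deletion bound.\<close>
    also have "\<dots> = \<alpha> * \<mu>\<^sub>1 * \<mu>\<^sub>3 * (\<alpha> * (1 - exp (- \<mu>\<^sub>1)) * h T) / (\<mu>\<^sub>1 + \<alpha> * real \<tau>)"
      using D by (simp add: exp_minus field_simps power2_eq_square)
    also have "\<dots> \<le> \<alpha> * \<mu>\<^sub>1 * \<mu>\<^sub>3 * h S2 / (\<mu>\<^sub>1 + \<alpha> * real \<tau>)"
      using greedy \<mu> D by (intro divide_right_mono mult_left_mono) auto
    also have "\<dots> \<le> h (S \<ominus> U)"
    proof -
      have "\<alpha> * \<mu>\<^sub>1 * \<mu>\<^sub>3 * h S2 \<le> (\<mu>\<^sub>1 + \<alpha> * real \<tau>) * h ((S1 @ S2) \<ominus> U)"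
        using robust_loss_bound[OF assms(11-14,10,9,6-8) S1V S2V disj dom card1] U S_eq by simp
      then show ?thesis
        using D by (simp add: S_eq divide_le_eq mult.commute)
    qed
    finally show "?c * robust_value h \<tau> S' \<le> h (S \<ominus> U)" .
  qed
qed

end
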